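(* Let $(\Delta_{m-1},C)$ be a spectral duality structure. For $\pi\in\Delta_{m-1}$, $$\pi\in\Sigma\iff\langle\pi,\mathbf n_\nu\rangle=0\ \text{ for all }\nu=1,\dots,N\iff\langle\pi,\mathbf d_O\rangle=0\ \text{ for every orbit }O,$$ and explicitly $$\Sigma=\Big\{\pi\in\Delta_{m-1}:\ \sqrt{\kappa(z)}\,\pi_z=\sqrt{\kappa(\sigma(z))}\,\pi_{\sigma(z)}\ \text{for every orbit }\{z,\sigma(z)\}\Big\},$$ the weights of neutral sites being unconstrained. Equivalently, $\Sigma$ is the intersection of $\Delta_{m-1}$ with a linear subspace of $\mathbb R^m$ of codimension $r=n_{\mathrm{pair}}$.
   Context: Let $m\ge2$ and let $Z=\{z_1,\dots,z_m\}$ be a set of $m$ distinct sites; coordinates of $\mathbb R^m$ are indexed by $Z$, and $\langle\cdot,\cdot\rangle$ is the standard pairing. $\Delta_{m-1}=\{\pi\in\mathbb R^m:\pi_z\ge0,\ \sum_z\pi_z=1\}$, with relative interior $\Delta_{m-1}^\circ$. A spectral duality structure is a pair $(\Delta_{m-1},C)$, with $C:\Delta_{m-1}\times(0,1)\to\mathbb R$ smooth, admitting a spectral representation, i.e. data such that: (S1) for each $\gamma\in(0,1)$, $\pi\mapsto C(\pi,\gamma)$ is $\mathcal C^1$ on $\Delta^\circ_{m-1}$ and extends continuously to the boundary; (S2) $C(\pi,\gamma)=\sum_z\pi_zu(z;\gamma)/\sum_z\pi_zs(z;\gamma)$ with denominator strictly positive on $\Delta_{m-1}\times(0,1)$, where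 $u(z;\gamma)=\sum_{\nu=1}^Nf_\nu(\gamma)A_\nu(z)$, $s(z;\gamma)=\sum_{\nu=1}^Nf_\nu(\gamma)(A_\nu(z)+B_\nu(z))$, the $f_\nu$ are real-analytic and linearly independent on $(0,1)$, and the matrix $(A_\nu(z_i))\in\mathbb R^{N\times m}$ has full column rank $m\le N$; (S3) there are an involution $\sigma$ of $Z$ with at least one non-trivial pair, and weights $\kappa(z)>0$ independent of $\nu$, with $B_\nu(z)=\kappa(z)A_\nu(\sigma(z))$ for all $\nu,z$; (S4) there is $K>0$ with $\kappa(z)\kappa(\sigma(z))=K$ for all $z$. Put $C^\ast=1/(1+\sqrt K)$. An orbit is a pair $O=\{z,\sigma(z)\}$ with $\sigma(z)\neq z$; $n_{\mathrm{pair}}$ is the number of orbits; a neutral site is a fixed point of $\sigma$. The orbit director $\mathbf d_O\in\mathbb R^m$ has component $\sqrt{\kappa(z)}$ at a fixed representative $z$ of $O$, $-\sqrt{\kappa(\sigma(z))}$ at $\sigma(z)$, and $0$ elsewhere. The normal directions are $[\mathbf n_\nu]_z=(1-C^\ast)A_\nu(z)-C^\ast\kappa(z)A_\nu(\sigma(z))$. $r$ is the dimension of $V=\operatorname{span}\{\psi(\gamma):\gamma\in(0,1)\}$, $\psi_z(\gamma)=u(z;\gamma)-C^\ast s(z;\gamma)$. The separatrix is $\Sigma=\{\pi\in\Delta_{m-1}: C(\pi,\gamma)\text{ is constant in }\gamma\in(0,1)\}$. *)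

theory Defs
  imports "HOL-Analysis.Analysis"
begin

section \<open>Regularity classes\<close>

text \<open>
  \<open>Ck_on k U g\<close> is meant for open \<open>U\<close>: \<open>g\<close> is \<open>k\<close> times continuously differentiable on \<open>U\<close>,
  expressed through iterated directional derivatives.
\<close>

primrec Ck_on :: "nat \<Rightarrow> 'a::real_normed_vector set \<Rightarrow> ('a \<Rightarrow> real) \<Rightarrow> bool" where
  "Ck_on 0 U g \<longleftrightarrow> continuous_on U g"
| "Ck_on (Suc k) U g \<longleftrightarrow>
     (\<exists>g'. (\<forall>x\<in>U. (g has_derivative g' x) (at x)) \<and> (\<forall>v. Ck_on k U (\<lambda>x. g' x v)))"

text \<open>
  The simplex is not open in \<open>real ^ 'z\<close>. As usual, a function on an arbitrary set is of class
  \<open>C\<^sup>1\<close> (or smooth) if locally it is the restriction of a \<open>C\<^sup>1\<close> (or smooth) function defined on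
  an open set of the ambient space.
\<close>

definition C1_on_set :: "'a::real_normed_vector set \<Rightarrow> ('a \<Rightarrow> real) \<Rightarrow> bool" where
  "C1_on_set S h \<longleftrightarrow>
     (\<forall>x\<in>S. \<exists>U g. open U \<and> x \<in> U \<and> Ck_on 1 U g \<and> (\<forall>y\<in>S \<inter> U. g y = h y))"

definition smooth_on_set :: "'a::real_normed_vector set \<Rightarrow> ('a \<Rightarrow> real) \<Rightarrow> bool" where
  "smooth_on_set S h \<longleftrightarrow>
     (\<forall>x\<in>S. \<exists>U g. open U \<and> x \<in> U \<and> (\<forall>k. Ck_on k U g) \<and> (\<forall>y\<in>S \<inter> U. g y = h y))"

definition real_analytic_on :: "(real \<Rightarrow> real) \<Rightarrow> real set \<Rightarrow> bool" where
  "real_analytic_on h S \<longleftrightarrow>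
     (\<forall>x\<in>S. \<exists>e>0. \<exists>a. \<forall>y. \<bar>y - x\<bar> < e \<longrightarrow> (\<lambda>n. a n * (y - x) ^ n) sums h y)"

definition lin_indep_on :: "('n::finite \<Rightarrow> real \<Rightarrow> real) \<Rightarrow> real set \<Rightarrow> bool" where
  "lin_indep_on f S \<longleftrightarrow>
     (\<forall>c. (\<forall>t\<in>S. (\<Sum>\<nu>\<in>UNIV. c \<nu> * f \<nu> t) = 0) \<longrightarrow> (\<forall>\<nu>. c \<nu> = 0))"


section \<open>Spectral duality structures\<close>

text \<open>
  The finite type \<open>'z\<close> is the set of the \<open>m = CARD('z)\<close> sites and the finite type \<open>'n\<close> indexes the
  \<open>N = CARD('n)\<close> spectral functions, so \<open>A $ \<nu> $ z\<close> is \<open>A\<^sub>\<nu>(z)\<close>.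
\<close>

definition prob_simplex :: "(real ^ 'z) set" where
  "prob_simplex = {p. (\<forall>z. 0 \<le> p $ z) \<and> (\<Sum>z\<in>UNIV. p $ z) = 1}"

definition spec_u :: "('n \<Rightarrow> real \<Rightarrow> real) \<Rightarrow> real ^ 'z ^ 'n \<Rightarrow> 'z \<Rightarrow> real \<Rightarrow> real" where
  "spec_u f A z \<gamma> = (\<Sum>\<nu>\<in>UNIV. f \<nu> \<gamma> * A $ \<nu> $ z)"

definition spec_s ::
    "('n \<Rightarrow> real \<Rightarrow> real) \<Rightarrow> real ^ 'z ^ 'n \<Rightarrow> real ^ 'z ^ 'n \<Rightarrow> 'z \<Rightarrow> real \<Rightarrow> real" where
  "spec_s f A B z \<gamma> = (\<Sum>\<nu>\<in>UNIV. f \<nu> \<gamma> * (A $ \<nu> $ z + B $ \<nu> $ z))"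

text \<open>
  Only the values of \<open>C\<close> on \<open>prob_simplex \<times> {0<..<1}\<close> matter. As \<open>C\<close> is already given on the
  closed simplex, extending continuously to the boundary means continuity there.
\<close>

locale spectral_duality_structure =
  fixes C :: "real ^ 'z::finite \<Rightarrow> real \<Rightarrow> real"
    and f :: "'n::finite \<Rightarrow> real \<Rightarrow> real"
    and A B :: "real ^ 'z ^ 'n"
    and \<sigma> :: "'z \<Rightarrow> 'z"
    and \<kappa> :: "'z \<Rightarrow> real"
    and K :: real
  assumes sites: "2 \<le> CARD('z)"
    and C_smooth: "smooth_on_set (prob_simplex \<times> {0<..<1}) (\<lambda>(p, \<gamma>). C p \<gamma>)"
    and S1_C1: "\<And>\<gamma>. \<gamma> \<in> {0<..<1} \<Longrightarrow> C1_on_set (rel_interior prob_simplex) (\<lambda>p. C p \<gamma>)"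
    and S1_cont: "\<And>\<gamma>. \<gamma> \<in> {0<..<1} \<Longrightarrow> continuous_on prob_simplex (\<lambda>p. C p \<gamma>)"
    and S2_denom_pos: "\<And>p \<gamma>. p \<in> prob_simplex \<Longrightarrow> \<gamma> \<in> {0<..<1} \<Longrightarrow>
          0 < (\<Sum>z\<in>UNIV. p $ z * spec_s f A B z \<gamma>)"
    and S2_repr: "\<And>p \<gamma>. p \<in> prob_simplex \<Longrightarrow> \<gamma> \<in> {0<..<1} \<Longrightarrow>
          C p \<gamma> = (\<Sum>z\<in>UNIV. p $ z * spec_u f A z \<gamma>) / (\<Sum>z\<in>UNIV. p $ z * spec_s f A B z \<gamma>)"
    and S2_analytic: "\<And>\<nu>. real_analytic_on (f \<nu>) {0<..<1}"
    and S2_indep: "lin_indep_on f {0<..<1}"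
    and S2_rank: "rank A = CARD('z)" "CARD('z) \<le> CARD('n)"
    and S3_involution: "\<And>z. \<sigma> (\<sigma> z) = z"
    and S3_nontrivial: "\<exists>z. \<sigma> z \<noteq> z"
    and S3_weights_pos: "\<And>z. 0 < \<kappa> z"
    and S3_B: "\<And>\<nu> z. B $ \<nu> $ z = \<kappa> z * A $ \<nu> $ (\<sigma> z)"
    and S4_K_pos: "0 < K"
    and S4_product: "\<And>z. \<kappa> z * \<kappa> (\<sigma> z) = K"

definition C_star :: "real \<Rightarrow> real" where
  "C_star K = 1 / (1 + sqrt K)"

definition orbits :: "('z \<Rightarrow> 'z) \<Rightarrow> 'z set set" where
  "orbits \<sigma> = {{z, \<sigma> z} |z. \<sigma> z \<noteq> z}"

definition n_pair :: "('z \<Rightarrow> 'z) \<Rightarrow> nat" where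
  "n_pair \<sigma> = card (orbits \<sigma>)"

text \<open>The director of the orbit \<open>{z, \<sigma> z}\<close>, for \<open>\<sigma> z \<noteq> z\<close> and the chosen representative \<open>z\<close>.\<close>

definition orbit_director :: "('z \<Rightarrow> 'z) \<Rightarrow> ('z \<Rightarrow> real) \<Rightarrow> 'z \<Rightarrow> real ^ 'z" where
  "orbit_director \<sigma> \<kappa> z =
     (\<chi> w. if w = z then sqrt (\<kappa> z) else if w = \<sigma> z then - sqrt (\<kappa> (\<sigma> z)) else 0)"

definition normal_direction ::
    "real ^ 'z ^ 'n \<Rightarrow> ('z \<Rightarrow> 'z) \<Rightarrow> ('z \<Rightarrow> real) \<Rightarrow> real \<Rightarrow> 'n \<Rightarrow> real ^ 'z" where
  "normal_direction A \<sigma> \<kappa> K \<nu> =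
     (\<chi> z. (1 - C_star K) * A $ \<nu> $ z - C_star K * \<kappa> z * A $ \<nu> $ (\<sigma> z))"

definition psi ::
    "('n \<Rightarrow> real \<Rightarrow> real) \<Rightarrow> real ^ 'z ^ 'n \<Rightarrow> real ^ 'z ^ 'n \<Rightarrow> real \<Rightarrow> real \<Rightarrow> real ^ 'z" where
  "psi f A B K \<gamma> = (\<chi> z. spec_u f A z \<gamma> - C_star K * spec_s f A B z \<gamma>)"

definition spectral_rank ::
    "('n \<Rightarrow> real \<Rightarrow> real) \<Rightarrow> real ^ 'z ^ 'n \<Rightarrow> real ^ 'z ^ 'n \<Rightarrow> real \<Rightarrow> nat" where
  "spectral_rank f A B K = dim (span (psi f A B K ` {0<..<1}))"

definition separatrix :: "(real ^ 'z \<Rightarrow> real \<Rightarrow> real) \<Rightarrow> (real ^ 'z) set" where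
  "separatrix C = {p \<in> prob_simplex. C p constant_on {0<..<1}}"

end

theory Submission
  imports Defs
begin

text \<open>
  Since the \<open>f \<nu>\<close> are linearly independent and \<open>A\<close> is injective, \<open>C p = c\<close> on \<open>{0<..<1}\<close> amounts to
  \<open>(1 - c) * p z = c * \<kappa> (\<sigma> z) * p (\<sigma> z)\<close> for all \<open>z\<close>. Using this relation at \<open>z\<close> and
  at \<open>\<sigma> z\<close>, where \<open>p z > 0\<close>, yields \<open>(1 - c)\<^sup>2 = c\<^sup>2 * K\<close>, and positivity of the weights
  selects the root \<open>c = C_star K\<close>. For this \<open>c\<close> the relation is the balance condition
  \<open>sqrt (\<kappa> z) * p z = sqrt (\<kappa> (\<sigma> z)) * p (\<sigma> z)\<close>. The balanced vectors form the orthogonal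
  complement both of the span of \<open>psi\<close> and of the pairwise orthogonal orbit directors, so
  the two spans have the same dimension.
\<close>

text \<open>The equation is trivial at neutral sites, so ranging over all sites imposes only the
  orbit conditions. Leaving out positivity and normalization makes the set a linear subspace, whose
  dimension can be counted.\<close>

definition balanced :: "('z \<Rightarrow> 'z) \<Rightarrow> ('z \<Rightarrow> real) \<Rightarrow> (real ^ 'z) set" where
  "balanced \<sigma> \<kappa> = {p. \<forall>z. sqrt (\<kappa> z) * p $ z = sqrt (\<kappa> (\<sigma> z)) * p $ (\<sigma> z)}"

lemma subspace_balanced: "subspace (balanced \<sigma> \<kappa>)"
  by (auto simp: subspace_def balanced_def algebra_simps)

text \<open>Orthogonality to \<open>S\<close> passes to \<open>span S\<close>, where the dimension
  formula for subspaces applies.\<close>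

lemma dim_orthogonal_complement:
  fixes S :: "'a::euclidean_space set"
  shows "dim {y. \<forall>x\<in>S. x \<bullet> y = 0} + dim S = DIM('a)"
proof -
  have "{y. \<forall>x\<in>span S. orthogonal x y} = {y. \<forall>x\<in>S. x \<bullet> y = 0}"
  proof (intro set_eqI iffI)
    fix y assume "y \<in> {y. \<forall>x\<in>S. x \<bullet> y = 0}"
    then have "orthogonal y x" if "x \<in> span S" for x
      by (intro orthogonal_to_span[OF that]) (auto simp: orthogonal_def inner_commute)
    then show "y \<in> {y. \<forall>x\<in>span S. orthogonal x y}"
      by (simp add: orthogonal_commute)
  qed (auto simp: orthogonal_def span_base)
  with dim_subspace_orthogonal_to_vectors[of "span S" UNIV] show ?thesis
    by simp
qed

lemma orbits_pair_iff: "{z, \<sigma> z} \<in> orbits \<sigma> \<longleftrightarrow> \<sigma> z \<noteq> z"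
  by (auto simp: orbits_def doubleton_eq_iff)

context spectral_duality_structure
begin

section \<open>Constancy of \<open>C p\<close> as a relation between paired sites\<close>

lemma sum_sigma: "(\<Sum>z\<in>UNIV. g (\<sigma> z)) = (\<Sum>z\<in>UNIV. g z)"
  by (rule sum.reindex_bij_witness[of _ \<sigma> \<sigma>]) (auto simp: S3_involution)

lemma orbit_eq: "Q \<in> orbits \<sigma> \<Longrightarrow> w \<in> Q \<Longrightarrow> Q = {w, \<sigma> w} \<and> \<sigma> w \<noteq> w"
  by (auto simp: orbits_def S3_involution)

text \<open>Expanding \<open>u\<close> and \<open>s\<close> leaves a combination of the
  \<open>f \<nu>\<close>. Reindexing by \<sigma> moves the reflection from \<open>A\<close> onto
  \<open>p\<close>, so that each coefficient is a coordinate of \<open>A\<close> applied to one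
  vector.\<close>

lemma numerator_minus_level:
  "(\<Sum>z\<in>UNIV. p $ z * spec_u f A z \<gamma>) - c * (\<Sum>z\<in>UNIV. p $ z * spec_s f A B z \<gamma>) =
   (\<Sum>\<nu>\<in>UNIV. (A *v (\<chi> z. (1 - c) * p $ z - c * \<kappa> (\<sigma> z) * p $ (\<sigma> z))) $ \<nu> * f \<nu> \<gamma>)"
proof -
  have \<nu>: "(A *v (\<chi> z. (1 - c) * p $ z - c * \<kappa> (\<sigma> z) * p $ (\<sigma> z))) $ \<nu>
      = (\<Sum>z\<in>UNIV. p $ z * (A $ \<nu> $ z - c * (A $ \<nu> $ z + B $ \<nu> $ z)))" for \<nu>
  proof -
    have "(\<Sum>z\<in>UNIV. A $ \<nu> $ z * (\<kappa> (\<sigma> z) * p $ (\<sigma> z))) = (\<Sum>z\<in>UNIV. A $ \<nu> $ \<sigma> z * (\<kappa> z * p $ z))"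
      using sum_sigma[of "\<lambda>z. A $ \<nu> $ \<sigma> z * (\<kappa> z * p $ z)"] by (simp add: S3_involution)
    then show ?thesis
      by (simp add: matrix_vector_mult_def S3_B algebra_simps sum.distrib sum_subtractf
          flip: sum_distrib_left)
  qed
  have "(\<Sum>z\<in>UNIV. p $ z * spec_u f A z \<gamma>) - c * (\<Sum>z\<in>UNIV. p $ z * spec_s f A B z \<gamma>)
     = (\<Sum>z\<in>UNIV. \<Sum>\<nu>\<in>UNIV. p $ z * (A $ \<nu> $ z - c * (A $ \<nu> $ z + B $ \<nu> $ z)) * f \<nu> \<gamma>)"
    unfolding spec_u_def spec_s_def sum_distrib_left sum_subtractf[symmetric]
    by (intro sum.cong refl) (simp add: algebra_simps)
  also have "\<dots> = (\<Sum>\<nu>\<in>UNIV. \<Sum>z\<in>UNIV. p $ z * (A $ \<nu> $ z - c * (A $ \<nu> $ z + B $ \<nu> $ z)) * f \<nu> \<gamma>)"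
    by (rule sum.swap)
  finally show ?thesis
    by (simp add: \<nu> sum_distrib_right)
qed

lemma matrix_mult_eq_0_iff: "(\<forall>\<nu>. (A *v x) $ \<nu> = 0) \<longleftrightarrow> x = 0"
proof -
  have "inj ((*v) A)"
    using S2_rank(1) full_rank_injective by blast
  then have "A *v x = 0 \<longleftrightarrow> x = 0"
    by (metis injD matrix_vector_mult_0_right)
  then show ?thesis
    by (simp add: vec_eq_iff)
qed

lemma combination_eq_0_iff:
  "(\<forall>\<gamma>\<in>{0<..<1}. (\<Sum>\<nu>\<in>UNIV. a \<nu> * f \<nu> \<gamma>) = 0) \<longleftrightarrow> (\<forall>\<nu>. a \<nu> = 0)"
  using S2_indep by (auto simp: lin_indep_on_def)

text \<open>Linear independence of the \<open>f \<nu>\<close> kills the coefficients, and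
  injectivity of \<open>A\<close> then kills the vector. \<open>p\<close> is an arbitrary vector, so
  that the orthogonal complement of \<open>psi\<close> can be described too.\<close>

lemma level_iff:
  "(\<forall>\<gamma>\<in>{0<..<1}. (\<Sum>z\<in>UNIV. p $ z * spec_u f A z \<gamma>) - c * (\<Sum>z\<in>UNIV. p $ z * spec_s f A B z \<gamma>) = 0)
   \<longleftrightarrow> (\<forall>z. (1 - c) * p $ z = c * \<kappa> (\<sigma> z) * p $ (\<sigma> z))"
  unfolding numerator_minus_level combination_eq_0_iff matrix_mult_eq_0_iff
  by (simp add: vec_eq_iff)

lemma C_eq_iff:
  assumes "p \<in> prob_simplex"
  shows "(\<forall>\<gamma>\<in>{0<..<1}. C p \<gamma> = c) \<longleftrightarrow> (\<forall>z. (1 - c) * p $ z = c * \<kappa> (\<sigma> z) * p $ (\<sigma> z))"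
proof -
  have "C p \<gamma> = c \<longleftrightarrow>
      (\<Sum>z\<in>UNIV. p $ z * spec_u f A z \<gamma>) - c * (\<Sum>z\<in>UNIV. p $ z * spec_s f A B z \<gamma>) = 0"
    if "\<gamma> \<in> {0<..<1}" for \<gamma>
    using S2_denom_pos[OF assms that] S2_repr[OF assms that] by (simp add: divide_eq_eq)
  then show ?thesis
    unfolding level_iff[symmetric] by simp
qed

section \<open>The constant level \<open>C_star K\<close> and the balance condition\<close>

lemma C_star_pos: "0 < C_star K"
  using S4_K_pos by (simp add: C_star_def add_pos_pos)

lemma one_minus_C_star: "1 - C_star K = C_star K * sqrt K"
proof -
  have "1 + sqrt K \<noteq> 0"
    using S4_K_pos real_sqrt_gt_zero[of K] by linarith
  then show ?thesis
    by (simp add: C_star_def field_simps)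
qed

text \<open>Since \<open>sqrt K\<close> is the product of the roots of the two paired weights, the
  difference of the sides on the left is the positive factor
  \<open>C_star K * sqrt (\<kappa> (\<sigma> z))\<close> times the difference of the sides on the
  right.\<close>

lemma balance_iff:
  "(1 - C_star K) * x = C_star K * \<kappa> (\<sigma> z) * y \<longleftrightarrow> sqrt (\<kappa> z) * x = sqrt (\<kappa> (\<sigma> z)) * y"
proof -
  define a b where "a = sqrt (\<kappa> z)" and "b = sqrt (\<kappa> (\<sigma> z))"
  have b: "0 < b" "\<kappa> (\<sigma> z) = b * b"
    using S3_weights_pos[of "\<sigma> z"] by (simp_all add: b_def)
  have "sqrt K = a * b"
    by (simp add: a_def b_def S4_product flip: real_sqrt_mult)
  then have "(1 - C_star K) * x - C_star K * \<kappa> (\<sigma> z) * y = C_star K * b * (a * x - b * y)"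
    unfolding one_minus_C_star b(2) by (simp add: algebra_simps)
  moreover have "C_star K * b \<noteq> 0"
    using C_star_pos b(1) by simp
  ultimately have "(1 - C_star K) * x - C_star K * \<kappa> (\<sigma> z) * y = 0 \<longleftrightarrow> a * x - b * y = 0"
    by simp
  then show ?thesis
    by (simp add: a_def b_def)
qed

lemma balanced_iff_level:
  "p \<in> balanced \<sigma> \<kappa> \<longleftrightarrow> (\<forall>z. (1 - C_star K) * p $ z = C_star K * \<kappa> (\<sigma> z) * p $ (\<sigma> z))"
  by (simp add: balanced_def balance_iff)

lemma constant_level_unique:
  assumes p: "p \<in> prob_simplex"
    and level: "\<And>z. (1 - c) * p $ z = c * \<kappa> (\<sigma> z) * p $ (\<sigma> z)"
  shows "c = C_star K"
proof -
  have nonneg: "0 \<le> p $ z" for z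
    using p by (simp add: prob_simplex_def)
  have "\<exists>z. p $ z \<noteq> 0"
  proof (rule ccontr)
    assume "\<nexists>z. p $ z \<noteq> 0"
    then show False using p by (simp add: prob_simplex_def)
  qed
  then obtain z where z: "0 < p $ z"
    using nonneg by (metis order_le_less)
  \<comment> \<open>The second factor \<open>1 - c\<close> allows the relation to be used at
    \<open>z\<close> and then at \<open>\<sigma> z\<close>, which returns to
    \<open>p $ z\<close>.\<close>
  have "(1 - c)\<^sup>2 * p $ z = (1 - c) * ((1 - c) * p $ z)"
    by (simp add: power2_eq_square)
  also have "\<dots> = c * \<kappa> (\<sigma> z) * ((1 - c) * p $ (\<sigma> z))"
    unfolding level[of z] by (simp only: mult_ac)
  also have "\<dots> = c\<^sup>2 * (\<kappa> z * \<kappa> (\<sigma> z)) * p $ z"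
    using level[of "\<sigma> z"] by (simp add: power2_eq_square S3_involution)
  finally have "(1 - c)\<^sup>2 = (c * sqrt K)\<^sup>2"
    using z S4_K_pos by (simp add: S4_product power_mult_distrib)
  then consider "1 - c = c * sqrt K" | "1 - c = - (c * sqrt K)"
    using power2_eq_iff by blast
  then show ?thesis
  proof cases
    case 1
    moreover have "1 + sqrt K \<noteq> 0"
      using real_sqrt_gt_zero[OF S4_K_pos] by linarith
    ultimately show ?thesis
      by (simp add: C_star_def eq_divide_eq algebra_simps)
  next
    \<comment> \<open>The root of the wrong sign: here \<open>c = 0\<close> would give
      \<open>1 = 0\<close>, and after cancelling \<open>c\<close> a negative number equals a
      non-negative one.\<close>
    case 2
    then have "c \<noteq> 0" by auto
    moreover have "c * - (sqrt K * p $ z) = c * (\<kappa> (\<sigma> z) * p $ (\<sigma> z))"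
      using level[of z] unfolding 2 by (simp add: algebra_simps)
    ultimately have "- (sqrt K * p $ z) = \<kappa> (\<sigma> z) * p $ (\<sigma> z)"
      by (rule mult_left_cancel[THEN iffD1])
    moreover have "0 \<le> \<kappa> (\<sigma> z) * p $ (\<sigma> z)"
      using S3_weights_pos[of "\<sigma> z"] nonneg by simp
    moreover have "0 < sqrt K * p $ z"
      using z S4_K_pos by simp
    ultimately show ?thesis by linarith
  qed
qed

text \<open>Constancy does not prescribe the value, but \<open>constant_level_unique\<close> forces
  it to be \<open>C_star K\<close>.\<close>

lemma separatrix_eq: "separatrix C = prob_simplex \<inter> balanced \<sigma> \<kappa>"
proof -
  have "C p constant_on {0<..<1} \<longleftrightarrow> p \<in> balanced \<sigma> \<kappa>" if p: "p \<in> prob_simplex" for p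
    unfolding constant_on_def C_eq_iff[OF p] balanced_iff_level
    using constant_level_unique[OF p] by blast
  then show ?thesis
    by (auto simp: separatrix_def)
qed

section \<open>Balanced vectors as an orthogonal complement: \<open>psi\<close> and the normal
  directions\<close>

lemma inner_psi:
  "p \<bullet> psi f A B K \<gamma> =
   (\<Sum>z\<in>UNIV. p $ z * spec_u f A z \<gamma>) - C_star K * (\<Sum>z\<in>UNIV. p $ z * spec_s f A B z \<gamma>)"
  by (simp add: inner_vec_def psi_def algebra_simps sum_subtractf sum_distrib_left)

lemma balanced_eq_orthogonal_psi:
  "balanced \<sigma> \<kappa> = {p. \<forall>x \<in> psi f A B K ` {0<..<1}. x \<bullet> p = 0}"
  unfolding set_eq_iff balanced_iff_level level_iff[symmetric]
  by (simp add: inner_psi inner_commute[of "psi _ _ _ _ _"])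

text \<open>This is the coefficient of \<open>f \<nu>\<close> in
  \<open>numerator_minus_level\<close> at \<open>c = C_star K\<close>: \<open>psi\<close> is the
  combination of the normal directions with coefficients \<open>f \<nu>\<close>.\<close>

lemma inner_normal_direction:
  "p \<bullet> normal_direction A \<sigma> \<kappa> K \<nu> =
   (A *v (\<chi> z. (1 - C_star K) * p $ z - C_star K * \<kappa> (\<sigma> z) * p $ (\<sigma> z))) $ \<nu>"
proof -
  have "(\<Sum>z\<in>UNIV. A $ \<nu> $ z * (\<kappa> (\<sigma> z) * p $ (\<sigma> z))) = (\<Sum>z\<in>UNIV. A $ \<nu> $ \<sigma> z * (\<kappa> z * p $ z))"
    using sum_sigma[of "\<lambda>z. A $ \<nu> $ \<sigma> z * (\<kappa> z * p $ z)"] by (simp add: S3_involution)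
  then show ?thesis
    by (simp add: inner_vec_def normal_direction_def matrix_vector_mult_def algebra_simps
        sum.distrib sum_subtractf flip: sum_distrib_left)
qed

lemma balanced_iff_normal_direction:
  "p \<in> balanced \<sigma> \<kappa> \<longleftrightarrow> (\<forall>\<nu>. p \<bullet> normal_direction A \<sigma> \<kappa> K \<nu> = 0)"
  unfolding inner_normal_direction matrix_mult_eq_0_iff balanced_iff_level
  by (simp add: vec_eq_iff)

section \<open>Orbit directors and neutral sites\<close>

lemma inner_orbit_director:
  assumes "\<sigma> w \<noteq> w"
  shows "p \<bullet> orbit_director \<sigma> \<kappa> w = sqrt (\<kappa> w) * p $ w - sqrt (\<kappa> (\<sigma> w)) * p $ (\<sigma> w)"
proof -
  have "p \<bullet> orbit_director \<sigma> \<kappa> w = (\<Sum>z\<in>{w, \<sigma> w}. p $ z * orbit_director \<sigma> \<kappa> w $ z)"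
    unfolding inner_vec_def
    by (simp, rule sum.mono_neutral_cong_right) (auto simp: orbit_director_def)
  \<comment> \<open>The sum has two distinct terms because \<open>w\<close> is not fixed by
    \<sigma>.\<close>
  then show ?thesis
    using assms by (auto simp: orbit_director_def)
qed

lemma balanced_iff_orbits:
  "p \<in> balanced \<sigma> \<kappa> \<longleftrightarrow>
   (\<forall>z. {z, \<sigma> z} \<in> orbits \<sigma> \<longrightarrow> sqrt (\<kappa> z) * p $ z = sqrt (\<kappa> (\<sigma> z)) * p $ (\<sigma> z))"
proof -
  have "sqrt (\<kappa> z) * p $ z = sqrt (\<kappa> (\<sigma> z)) * p $ (\<sigma> z)" if "\<sigma> z = z" for z
    by (simp add: that)
  then show ?thesis
    unfolding balanced_def orbits_pair_iff by blast
qed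

lemma balanced_iff_orbit_director:
  assumes rep: "\<And>Q. Q \<in> orbits \<sigma> \<Longrightarrow> rep Q \<in> Q"
  shows "p \<in> balanced \<sigma> \<kappa> \<longleftrightarrow> (\<forall>Q \<in> orbits \<sigma>. p \<bullet> orbit_director \<sigma> \<kappa> (rep Q) = 0)"
    (is "_ \<longleftrightarrow> ?R")
proof
  assume p: "p \<in> balanced \<sigma> \<kappa>"
  show ?R
  proof
    fix Q assume "Q \<in> orbits \<sigma>"
    then have "\<sigma> (rep Q) \<noteq> rep Q"
      using orbit_eq[OF _ rep] by simp
    with p show "p \<bullet> orbit_director \<sigma> \<kappa> (rep Q) = 0"
      by (simp add: inner_orbit_director balanced_def)
  qed
next
  assume R: ?R
  show "p \<in> balanced \<sigma> \<kappa>"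
    unfolding balanced_iff_orbits
  proof (intro allI impI)
    fix z assume Q: "{z, \<sigma> z} \<in> orbits \<sigma>"
    \<comment> \<open>The representative may be either site of the orbit; the balance equation is
      symmetric under exchanging them.\<close>
    define w where "w = rep {z, \<sigma> z}"
    have "w = z \<or> w = \<sigma> z"
      using rep[OF Q] by (auto simp: w_def)
    moreover have "\<sigma> w \<noteq> w"
      using orbit_eq[OF Q rep[OF Q]] by (simp add: w_def)
    then have "sqrt (\<kappa> w) * p $ w = sqrt (\<kappa> (\<sigma> w)) * p $ (\<sigma> w)"
      using R Q inner_orbit_director[of w p] by (auto simp: w_def)
    ultimately show "sqrt (\<kappa> z) * p $ z = sqrt (\<kappa> (\<sigma> z)) * p $ (\<sigma> z)"
      by (auto simp: S3_involution)
  qed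
qed

text \<open>Distinct orbits are disjoint, so their directors have disjoint supports: they are
  nonzero and pairwise orthogonal, hence independent.\<close>

lemma dim_orbit_directors:
  assumes rep: "\<And>Q. Q \<in> orbits \<sigma> \<Longrightarrow> rep Q \<in> Q"
  shows "dim ((\<lambda>Q. orbit_director \<sigma> \<kappa> (rep Q)) ` orbits \<sigma>) = n_pair \<sigma>"
proof -
  let ?d = "\<lambda>Q. orbit_director \<sigma> \<kappa> (rep Q)"
  have orth: "?d P \<bullet> ?d Q = 0" if P: "P \<in> orbits \<sigma>" and Q: "Q \<in> orbits \<sigma>" and "P \<noteq> Q" for P Q
  proof -
    have PQ: "P = {rep P, \<sigma> (rep P)}" "Q = {rep Q, \<sigma> (rep Q)}" "\<sigma> (rep Q) \<noteq> rep Q"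
      using orbit_eq[OF P rep[OF P]] orbit_eq[OF Q rep[OF Q]] by simp_all
    then have "rep Q \<notin> P" "\<sigma> (rep Q) \<notin> P"
      using \<open>P \<noteq> Q\<close> orbit_eq[OF P, of "rep Q"] orbit_eq[OF P, of "\<sigma> (rep Q)"]
      by (auto simp: S3_involution)
    then have "?d P $ rep Q = 0" "?d P $ \<sigma> (rep Q) = 0"
      using PQ(1) by (auto simp: orbit_director_def)
    then show ?thesis
      by (simp add: inner_orbit_director PQ(3))
  qed
  have nz: "?d Q \<noteq> 0" if "Q \<in> orbits \<sigma>" for Q
  proof -
    have "?d Q $ rep Q \<noteq> 0"
      using S3_weights_pos[of "rep Q"] by (simp add: orbit_director_def)
    then show ?thesis by auto
  qed
  \<comment> \<open>A director shared by two orbits would be orthogonal to itself, hence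
    zero.\<close>
  have "inj_on ?d (orbits \<sigma>)"
    by (rule inj_onI) (metis orth nz inner_eq_zero_iff)
  moreover have "independent (?d ` orbits \<sigma>)"
  proof (rule pairwise_orthogonal_independent)
    show "pairwise orthogonal (?d ` orbits \<sigma>)"
      by (rule pairwise_imageI) (simp add: orthogonal_def orth)
    show "0 \<notin> ?d ` orbits \<sigma>"
      using nz by force
  qed
  ultimately show ?thesis
    by (simp add: dim_eq_card_independent card_image n_pair_def)
qed

text \<open>Makes precise that neutral weights are unconstrained: the mass of each pair in
  \<open>q\<close> is redistributed within the pair until it balances.\<close>

lemma exists_separatrix_same_neutral:
  assumes q: "q \<in> prob_simplex"
  shows "\<exists>p \<in> separatrix C. \<forall>z. \<sigma> z = z \<longrightarrow> p $ z = q $ z"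
proof
  \<comment> \<open>Shares inversely proportional to \<open>sqrt (\<kappa> z)\<close>, adding up to
    1 on a pair. At a neutral site the share is 1/2, which undoes the doubling in
    \<open>q $ z + q $ (\<sigma> z)\<close>.\<close>
  let ?w = "\<lambda>z. sqrt (\<kappa> (\<sigma> z)) / (sqrt (\<kappa> z) + sqrt (\<kappa> (\<sigma> z)))"
  let ?p = "\<chi> z. (q $ z + q $ (\<sigma> z)) * ?w z"
  have sqrt_pos: "0 < sqrt (\<kappa> z)" for z
    using S3_weights_pos by simp
  have denom: "sqrt (\<kappa> z) + sqrt (\<kappa> (\<sigma> z)) \<noteq> 0" for z
    using sqrt_pos[of z] sqrt_pos[of "\<sigma> z"] by linarith
  have w: "?w z + ?w (\<sigma> z) = 1" for z
    using denom[of z] by (simp add: S3_involution add.commute flip: add_divide_distrib)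
  have "(\<Sum>z\<in>UNIV. ?p $ z) = (\<Sum>z\<in>UNIV. q $ z * ?w z) + (\<Sum>z\<in>UNIV. q $ (\<sigma> z) * ?w z)"
    by (simp only: vec_lambda_beta distrib_right sum.distrib)
  also have "(\<Sum>z\<in>UNIV. q $ (\<sigma> z) * ?w z) = (\<Sum>z\<in>UNIV. q $ z * ?w (\<sigma> z))"
    using sum_sigma[of "\<lambda>z. q $ z * ?w (\<sigma> z)"] by (simp add: S3_involution)
  also have "(\<Sum>z\<in>UNIV. q $ z * ?w z) + \<dots> = (\<Sum>z\<in>UNIV. q $ z * (?w z + ?w (\<sigma> z)))"
    by (simp only: distrib_left sum.distrib)
  also have "\<dots> = 1"
    unfolding w using q by (simp add: prob_simplex_def)
  finally have "?p \<in> prob_simplex"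
    using q sqrt_pos by (simp add: prob_simplex_def less_imp_le)
  moreover have "?p \<in> balanced \<sigma> \<kappa>"
    by (simp add: balanced_def S3_involution add.commute mult_ac)
  ultimately show "?p \<in> separatrix C"
    by (simp add: separatrix_eq)
  show "\<forall>z. \<sigma> z = z \<longrightarrow> ?p $ z = q $ z"
    using sqrt_pos by (auto simp: field_simps less_imp_neq[symmetric])
qed

section \<open>Two counts of the codimension\<close>

lemma dim_balanced_spectral_rank: "dim (balanced \<sigma> \<kappa>) + spectral_rank f A B K = CARD('z)"
  unfolding balanced_eq_orthogonal_psi spectral_rank_def dim_span
  using dim_orthogonal_complement[of "psi f A B K ` {0<..<1}"] by simp

text \<open>The same subspace is also the orthogonal complement of the orbit directors, for any
  choice of representatives. Comparing the two counts identifies the spectral rank with the number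
  of orbits.\<close>

lemma dim_balanced_n_pair: "dim (balanced \<sigma> \<kappa>) + n_pair \<sigma> = CARD('z)"
proof -
  have "\<forall>Q \<in> orbits \<sigma>. \<exists>z. z \<in> Q"
    by (auto simp: orbits_def)
  then obtain rep where rep: "\<And>Q. Q \<in> orbits \<sigma> \<Longrightarrow> rep Q \<in> Q"
    by metis
  let ?D = "(\<lambda>Q. orbit_director \<sigma> \<kappa> (rep Q)) ` orbits \<sigma>"
  have "balanced \<sigma> \<kappa> = {p. \<forall>x \<in> ?D. x \<bullet> p = 0}"
    using balanced_iff_orbit_director[OF rep] by (auto simp: inner_commute)
  then show ?thesis
    using dim_orthogonal_complement[of ?D] dim_orbit_directors[OF rep] by simp
qed

end

theorem proposition5p2:
  fixes C :: "real ^ 'z::finite \<Rightarrow> real \<Rightarrow> real"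
    and f :: "'n::finite \<Rightarrow> real \<Rightarrow> real"
    and A B :: "real ^ 'z ^ 'n"
    and \<sigma> :: "'z \<Rightarrow> 'z"
    and \<kappa> :: "'z \<Rightarrow> real"
    and K :: real
    and rep :: "'z set \<Rightarrow> 'z"
  assumes "spectral_duality_structure C f A B \<sigma> \<kappa> K"
    and "\<And>Q. Q \<in> orbits \<sigma> \<Longrightarrow> rep Q \<in> Q"
  shows "(\<forall>p \<in> prob_simplex.
            (p \<in> separatrix C \<longleftrightarrow> (\<forall>\<nu>. p \<bullet> normal_direction A \<sigma> \<kappa> K \<nu> = 0)) \<and>
            ((\<forall>\<nu>. p \<bullet> normal_direction A \<sigma> \<kappa> K \<nu> = 0) \<longleftrightarrow>
               (\<forall>Q \<in> orbits \<sigma>. p \<bullet> orbit_director \<sigma> \<kappa> (rep Q) = 0)))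
       \<and> separatrix C =
            {p \<in> prob_simplex.
               \<forall>z. {z, \<sigma> z} \<in> orbits \<sigma> \<longrightarrow> sqrt (\<kappa> z) * p $ z = sqrt (\<kappa> (\<sigma> z)) * p $ (\<sigma> z)}
       \<and> (\<forall>q \<in> prob_simplex. \<exists>p \<in> separatrix C. \<forall>z. \<sigma> z = z \<longrightarrow> p $ z = q $ z)
       \<and> (\<exists>L. subspace L \<and> separatrix C = prob_simplex \<inter> L \<and>
            dim L + spectral_rank f A B K = CARD('z))
       \<and> spectral_rank f A B K = n_pair \<sigma>"
proof -
  interpret spectral_duality_structure C f A B \<sigma> \<kappa> K by fact
  note bal = balanced_iff_normal_direction balanced_iff_orbit_director[OF assms(2)]
  show ?thesis
  proof (intro conjI ballI)
    fix p :: "real ^ 'z" assume "p \<in> prob_simplex"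
    then show "p \<in> separatrix C \<longleftrightarrow> (\<forall>\<nu>. p \<bullet> normal_direction A \<sigma> \<kappa> K \<nu> = 0)"
      by (simp add: separatrix_eq balanced_iff_normal_direction)
    show "(\<forall>\<nu>. p \<bullet> normal_direction A \<sigma> \<kappa> K \<nu> = 0) \<longleftrightarrow>
        (\<forall>Q \<in> orbits \<sigma>. p \<bullet> orbit_director \<sigma> \<kappa> (rep Q) = 0)"
      using bal by blast
  next
    show "separatrix C = {p \<in> prob_simplex.
        \<forall>z. {z, \<sigma> z} \<in> orbits \<sigma> \<longrightarrow> sqrt (\<kappa> z) * p $ z = sqrt (\<kappa> (\<sigma> z)) * p $ (\<sigma> z)}"
      unfolding separatrix_eq using balanced_iff_orbits by blast
  next
    fix q :: "real ^ 'z" assume "q \<in> prob_simplex"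
    then show "\<exists>p \<in> separatrix C. \<forall>z. \<sigma> z = z \<longrightarrow> p $ z = q $ z"
      by (rule exists_separatrix_same_neutral)
  next
    show "\<exists>L. subspace L \<and> separatrix C = prob_simplex \<inter> L \<and>
        dim L + spectral_rank f A B K = CARD('z)"
      using subspace_balanced separatrix_eq dim_balanced_spectral_rank by blast
    show "spectral_rank f A B K = n_pair \<sigma>"
      using dim_balanced_spectral_rank dim_balanced_n_pair by linarith
  qed
qed

end
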